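(* Over $\mathsf{RCA_0}$, for every (external) natural number $k$, the following are equivalent: (1) (Termination Theorem for $k$ relations) for every binary relation $R$, if there exist well-founded relations $R_0,\dots,R_{k-1}$ with $R_0\cup\dots\cup R_{k-1}\supseteq R^+$, then $R$ is well-founded; (2) $\mathsf{WRT}^2_k$; (3) (Weak $H$-closure for $k$ relations) the union of any $k$ well-founded binary relations is $H$-well-founded.
   Context: $R^+$ denotes the transitive closure of $R$. A relation $R$ is well-founded if there is no infinite sequence $(a_n)$ with $a_{n+1}\,R\,a_n$ for all $n$; it is $H$-well-founded if there is no infinite sequence $(a_n)$ with $a_m\,R\,a_n$ for all $n<m$ (no infinite decreasing transitive sequence). $\mathsf{WRT}^2_k$: for every $P:[\mathbb{N}]^2\to k$ there exist $c<k$ and an infinite set $\{x_0<x_1<\cdots\}\subseteq\mathbb{N}$ with $P(\{x_i,x_{i+1}\})=c$ for all $i$. *)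

theory Defs
  imports Main
begin

text \<open>
  Structures for the language of second-order arithmetic, with Henkin semantics: the numbers are the
  elements of the type \<^typ>\<open>'a\<close>, and set quantifiers range over the collection \<open>sets\<close> only.
  The type variable is arbitrary, so non-standard models are included.
\<close>

record 'a l2_structure =
  zero :: 'a
  one :: 'a
  add :: "'a \<Rightarrow> 'a \<Rightarrow> 'a"
  mul :: "'a \<Rightarrow> 'a \<Rightarrow> 'a"
  lt :: "'a \<Rightarrow> 'a \<Rightarrow> bool"
  sets :: "'a set set"

datatype trm = Var nat | Zero | One | Add trm trm | Mul trm trm

text \<open>
  The arithmetical formulas. Set variables are named by natural numbers and occur only as parameters;
  the axiom schemes below need no others.
\<close>

datatype fm =
    Eq trm trm | Lt trm trm | Mem trm nat
  | Neg fm | Conj fm fm | Disj fm fm | Imp fm fm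
  | All nat fm | Ex nat fm

primrec tvars :: "trm \<Rightarrow> nat set" where
  "tvars (Var x) = {x}"
| "tvars Zero = {}"
| "tvars One = {}"
| "tvars (Add s t) = tvars s \<union> tvars t"
| "tvars (Mul s t) = tvars s \<union> tvars t"

primrec tval :: "'a l2_structure \<Rightarrow> (nat \<Rightarrow> 'a) \<Rightarrow> trm \<Rightarrow> 'a" where
  "tval M e (Var x) = e x"
| "tval M e Zero = zero M"
| "tval M e One = one M"
| "tval M e (Add s t) = add M (tval M e s) (tval M e t)"
| "tval M e (Mul s t) = mul M (tval M e s) (tval M e t)"

primrec sat :: "'a l2_structure \<Rightarrow> (nat \<Rightarrow> 'a) \<Rightarrow> (nat \<Rightarrow> 'a set) \<Rightarrow> fm \<Rightarrow> bool" where
  "sat M e E (Eq s t) \<longleftrightarrow> tval M e s = tval M e t"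
| "sat M e E (Lt s t) \<longleftrightarrow> lt M (tval M e s) (tval M e t)"
| "sat M e E (Mem t X) \<longleftrightarrow> tval M e t \<in> E X"
| "sat M e E (Neg p) \<longleftrightarrow> \<not> sat M e E p"
| "sat M e E (Conj p q) \<longleftrightarrow> sat M e E p \<and> sat M e E q"
| "sat M e E (Disj p q) \<longleftrightarrow> sat M e E p \<or> sat M e E q"
| "sat M e E (Imp p q) \<longleftrightarrow> (sat M e E p \<longrightarrow> sat M e E q)"
| "sat M e E (All x p) \<longleftrightarrow> (\<forall>a. sat M (e(x := a)) E p)"
| "sat M e E (Ex x p) \<longleftrightarrow> (\<exists>a. sat M (e(x := a)) E p)"

inductive bounded_fm :: "fm \<Rightarrow> bool" where
  "bounded_fm (Eq s t)"
| "bounded_fm (Lt s t)"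
| "bounded_fm (Mem t X)"
| "bounded_fm p \<Longrightarrow> bounded_fm (Neg p)"
| "bounded_fm p \<Longrightarrow> bounded_fm q \<Longrightarrow> bounded_fm (Conj p q)"
| "bounded_fm p \<Longrightarrow> bounded_fm q \<Longrightarrow> bounded_fm (Disj p q)"
| "bounded_fm p \<Longrightarrow> bounded_fm q \<Longrightarrow> bounded_fm (Imp p q)"
| "bounded_fm p \<Longrightarrow> x \<notin> tvars t \<Longrightarrow> bounded_fm (All x (Imp (Lt (Var x) t) p))"
| "bounded_fm p \<Longrightarrow> x \<notin> tvars t \<Longrightarrow> bounded_fm (Ex x (Conj (Lt (Var x) t) p))"

definition sigma01 :: "fm \<Rightarrow> bool" where
  "sigma01 p \<longleftrightarrow> (\<exists>x q. bounded_fm q \<and> p = Ex x q)"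

definition pi01 :: "fm \<Rightarrow> bool" where
  "pi01 p \<longleftrightarrow> (\<exists>x q. bounded_fm q \<and> p = All x q)"

definition basic_axioms :: "'a l2_structure \<Rightarrow> bool" where
  "basic_axioms M \<longleftrightarrow>
     (\<forall>n. add M n (one M) \<noteq> zero M) \<and>
     (\<forall>m n. add M m (one M) = add M n (one M) \<longrightarrow> m = n) \<and>
     (\<forall>m. add M m (zero M) = m) \<and>
     (\<forall>m n. add M m (add M n (one M)) = add M (add M m n) (one M)) \<and>
     (\<forall>m. mul M m (zero M) = zero M) \<and>
     (\<forall>m n. mul M m (add M n (one M)) = add M (mul M m n) m) \<and>
     (\<forall>m. \<not> lt M m (zero M)) \<and>
     (\<forall>m n. lt M m (add M n (one M)) \<longleftrightarrow> lt M m n \<or> m = n)"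

definition sigma01_induction :: "'a l2_structure \<Rightarrow> bool" where
  "sigma01_induction M \<longleftrightarrow>
     (\<forall>p x e E. sigma01 p \<longrightarrow> range E \<subseteq> sets M \<longrightarrow>
        sat M (e(x := zero M)) E p \<longrightarrow>
        (\<forall>n. sat M (e(x := n)) E p \<longrightarrow> sat M (e(x := add M n (one M))) E p) \<longrightarrow>
        (\<forall>n. sat M (e(x := n)) E p))"

definition delta01_comprehension :: "'a l2_structure \<Rightarrow> bool" where
  "delta01_comprehension M \<longleftrightarrow>
     (\<forall>p q x e E. sigma01 p \<longrightarrow> pi01 q \<longrightarrow> range E \<subseteq> sets M \<longrightarrow>
        (\<forall>n. sat M (e(x := n)) E p \<longleftrightarrow> sat M (e(x := n)) E q) \<longrightarrow>
        (\<exists>X\<in>sets M. \<forall>n. n \<in> X \<longleftrightarrow> sat M (e(x := n)) E p))"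

text \<open>
  A structure has at least one set (without this the two schemes, whose set parameters are total
  assignments, would be void).
\<close>

definition RCA0_model :: "'a l2_structure \<Rightarrow> bool" where
  "RCA0_model M \<longleftrightarrow>
     sets M \<noteq> {} \<and> basic_axioms M \<and> sigma01_induction M \<and> delta01_comprehension M"

text \<open>
  The notions below are read inside the structure: all sets, relations and sequences that are
  quantified over are (coded by) members of \<open>sets M\<close>, and all numbers are elements of the structure.
  Pairs are coded as usual by \<open>(i, j) = (i + j)\<^sup>2 + i\<close>. A set codes the binary relation consisting of the
  pairs whose codes it contains; its other elements are ignored.
\<close>

definition pair :: "'a l2_structure \<Rightarrow> 'a \<Rightarrow> 'a \<Rightarrow> 'a" where
  "pair M i j = add M (mul M (add M i j) (add M i j)) i"

definition rel :: "'a l2_structure \<Rightarrow> 'a set \<Rightarrow> 'a \<Rightarrow> 'a \<Rightarrow> bool" where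
  "rel M R x y \<longleftrightarrow> pair M x y \<in> R"

text \<open>
  Infinite sequences of numbers are graphs of total functions; \<open>rel M a n x\<close> then says \<open>a\<^sub>n = x\<close>.
\<close>

definition is_seq :: "'a l2_structure \<Rightarrow> 'a set \<Rightarrow> bool" where
  "is_seq M a \<longleftrightarrow> a \<in> sets M \<and> (\<forall>n. \<exists>!x. rel M a n x)"

definition well_founded :: "'a l2_structure \<Rightarrow> 'a set \<Rightarrow> bool" where
  "well_founded M R \<longleftrightarrow>
     \<not> (\<exists>a. is_seq M a \<and>
          (\<forall>n x y. rel M a n x \<longrightarrow> rel M a (add M n (one M)) y \<longrightarrow> rel M R y x))"

definition H_well_founded :: "'a l2_structure \<Rightarrow> 'a set \<Rightarrow> bool" where
  "H_well_founded M R \<longleftrightarrow>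
     \<not> (\<exists>a. is_seq M a \<and>
          (\<forall>n m x y. lt M n m \<longrightarrow> rel M a n x \<longrightarrow> rel M a m y \<longrightarrow> rel M R y x))"

text \<open>
  \<open>x R\<^sup>+ y\<close> holds iff there are \<open>n > 0\<close> and \<open>x = s\<^sub>0 R s\<^sub>1 R \<dots> R s\<^sub>n = y\<close>, where \<open>n\<close> is a number of the
  structure. A finite sequence is given by a sequence of which only the terms up to \<open>n\<close> matter.
  The transitive closure is a defined predicate because it need not exist as a set in \<open>sets M\<close>.
\<close>

definition trans_closure :: "'a l2_structure \<Rightarrow> 'a set \<Rightarrow> 'a \<Rightarrow> 'a \<Rightarrow> bool" where
  "trans_closure M R x y \<longleftrightarrow>
     (\<exists>s n. is_seq M s \<and> lt M (zero M) n \<and> rel M s (zero M) x \<and> rel M s n y \<and>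
        (\<forall>i u v. lt M i n \<longrightarrow> rel M s i u \<longrightarrow> rel M s (add M i (one M)) v \<longrightarrow> rel M R u v))"

definition termination_theorem :: "'a l2_structure \<Rightarrow> nat \<Rightarrow> bool" where
  "termination_theorem M k \<longleftrightarrow>
     (\<forall>R\<in>sets M.
        (\<exists>Rs :: nat \<Rightarrow> 'a set.
           (\<forall>i<k. Rs i \<in> sets M \<and> well_founded M (Rs i)) \<and>
           (\<forall>x y. trans_closure M R x y \<longrightarrow> (\<exists>i<k. rel M (Rs i) x y))) \<longrightarrow>
        well_founded M R)"

primrec nat_num :: "'a l2_structure \<Rightarrow> nat \<Rightarrow> 'a" where
  "nat_num M 0 = zero M"
| "nat_num M (Suc n) = add M (nat_num M n) (one M)"

text \<open>
  Colourings of the unordered pairs \<open>{x, y}\<close>, represented as functions of \<open>(x, y)\<close> with \<open>x < y\<close>.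
\<close>

definition colour :: "'a l2_structure \<Rightarrow> 'a set \<Rightarrow> 'a \<Rightarrow> 'a \<Rightarrow> 'a \<Rightarrow> bool" where
  "colour M P x y c \<longleftrightarrow> rel M P (pair M x y) c"

definition is_colouring :: "'a l2_structure \<Rightarrow> nat \<Rightarrow> 'a set \<Rightarrow> bool" where
  "is_colouring M k P \<longleftrightarrow> P \<in> sets M \<and>
     (\<forall>x y. lt M x y \<longrightarrow>
        (\<exists>!c. colour M P x y c) \<and> (\<forall>c. colour M P x y c \<longrightarrow> lt M c (nat_num M k)))"

definition increasing_enumeration :: "'a l2_structure \<Rightarrow> 'a set \<Rightarrow> 'a set \<Rightarrow> bool" where
  "increasing_enumeration M a X \<longleftrightarrow> is_seq M a \<and>
     (\<forall>i x y. rel M a i x \<longrightarrow> rel M a (add M i (one M)) y \<longrightarrow> lt M x y) \<and>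
     (\<forall>x. x \<in> X \<longleftrightarrow> (\<exists>i. rel M a i x))"

definition WRT2 :: "'a l2_structure \<Rightarrow> nat \<Rightarrow> bool" where
  "WRT2 M k \<longleftrightarrow>
     (\<forall>P. is_colouring M k P \<longrightarrow>
        (\<exists>c. lt M c (nat_num M k) \<and>
           (\<exists>X\<in>sets M. \<exists>a. increasing_enumeration M a X \<and>
              (\<forall>i x y. rel M a i x \<longrightarrow> rel M a (add M i (one M)) y \<longrightarrow> colour M P x y c))))"

definition weak_H_closure :: "'a l2_structure \<Rightarrow> nat \<Rightarrow> bool" where
  "weak_H_closure M k \<longleftrightarrow>
     (\<forall>Rs :: nat \<Rightarrow> 'a set.
        (\<forall>i<k. Rs i \<in> sets M \<and> well_founded M (Rs i)) \<longrightarrow> H_well_founded M (\<Union>i<k. Rs i))"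

end

theory Submission
  imports Defs
begin

text \<open>
  From a colouring \<open>P\<close> without a monochromatic chain, the relations \<open>x < y \<and> P {x, y} = c\<close> on \<open>(y, x)\<close>
  are well-founded and cover the transitive relation \<open>>\<close>, which is not well-founded; so (1) implies (2).
  If \<open>a\<close> is an infinite decreasing transitive sequence for a union, colour \<open>{n, m}\<close> by the least \<open>i\<close>
  with \<open>a\<^sub>m R\<^sub>i a\<^sub>n\<close>; a monochromatic chain is an infinite decreasing sequence for one \<open>R\<^sub>i\<close>, so (2) implies (3).
  Finally an infinite \<open>R\<close>-decreasing sequence is transitive for \<open>R\<^sup>+\<close>, so (3) implies (1).
  Since \<open>k\<close> is external, the numbers below it are the standard numerals, and no recursion inside the
  structure is needed.
\<close>

declare bounded_fm.intros [simp]

section \<open>Models of the base theory: axioms and induction\<close>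

locale RCA0 =
  fixes M :: "'a l2_structure"
  assumes model: "RCA0_model M"
begin

abbreviation zero_M ("\<zero>") where "\<zero> \<equiv> zero M"
abbreviation one_M ("\<one>") where "\<one> \<equiv> one M"
abbreviation add_M (infixl "\<oplus>" 65) where "x \<oplus> y \<equiv> add M x y"
abbreviation mul_M (infixl "\<otimes>" 70) where "x \<otimes> y \<equiv> mul M x y"
abbreviation lt_M (infix "\<prec>" 50) where "x \<prec> y \<equiv> lt M x y"

lemma basic: "basic_axioms M"
  using model by (simp add: RCA0_model_def)

lemma succ_neq_zero [simp]: "n \<oplus> \<one> \<noteq> \<zero>"
  and succ_inject [simp]: "m \<oplus> \<one> = n \<oplus> \<one> \<longleftrightarrow> m = n"
  and add_zero [simp]: "m \<oplus> \<zero> = m"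
  and add_succ [simp]: "m \<oplus> (n \<oplus> \<one>) = m \<oplus> n \<oplus> \<one>"
  and mul_zero [simp]: "m \<otimes> \<zero> = \<zero>"
  and mul_succ [simp]: "m \<otimes> (n \<oplus> \<one>) = m \<otimes> n \<oplus> m"
  and not_lt_zero [simp]: "\<not> m \<prec> \<zero>"
  and lt_succ [simp]: "m \<prec> n \<oplus> \<one> \<longleftrightarrow> m \<prec> n \<or> m = n"
  using basic unfolding basic_axioms_def by blast+

text \<open>Set assignments are total, so a formula without set variables still has to be evaluated
  under some member of \<open>sets M\<close>.\<close>

definition some_set :: "'a set" where
  "some_set = (SOME A. A \<in> sets M)"

lemma some_set [simp]: "some_set \<in> sets M"
  using model unfolding some_set_def RCA0_model_def by (metis some_in_eq)

text \<open>Fixes a convention for all later inductions: \<open>Var 0\<close> is the induction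
  variable, \<open>Var 1\<close> the existential witness, and number parameters sit at 2 and above.
  A value \<open>f n\<close>, which no term denotes, enters as \<open>Var 1\<close>, tied to
  \<open>n\<close> by membership of the pair in the graph of \<open>f\<close>.\<close>

lemma sigma_induct:
  assumes p: "bounded_fm p" and E: "range E \<subseteq> sets M"
    and Q: "\<And>n. Q n \<longleftrightarrow> (\<exists>z. sat M (e(0 := n, Suc 0 := z)) E p)"
    and zero: "Q \<zero>" and succ: "\<And>n. Q n \<Longrightarrow> Q (n \<oplus> \<one>)"
  shows "Q n"
proof -
  have "sigma01 (Ex 1 p)"
    using p by (auto simp: sigma01_def)
  moreover have "sigma01_induction M"
    using model by (simp add: RCA0_model_def)
  ultimately have "sat M (e(0 := \<zero>)) E (Ex 1 p) \<Longrightarrow>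
      (\<And>n. sat M (e(0 := n)) E (Ex 1 p) \<Longrightarrow> sat M (e(0 := n \<oplus> \<one>)) E (Ex 1 p)) \<Longrightarrow>
      sat M (e(0 := n)) E (Ex 1 p)"
    unfolding sigma01_induction_def using E by blast
  then show ?thesis
    using zero succ by (simp add: Q)
qed

subsection \<open>Arithmetic\<close>

lemma zero_add [simp]: "\<zero> \<oplus> n = n"
  by (rule sigma_induct[of "Eq (Add Zero (Var 0)) (Var 0)" "\<lambda>_. some_set" _ "\<lambda>_. \<zero>"]) auto

lemma succ_add: "m \<oplus> \<one> \<oplus> n = m \<oplus> n \<oplus> \<one>"
  by (rule sigma_induct[of "Eq (Add (Add (Var 2) One) (Var 0)) (Add (Add (Var 2) (Var 0)) One)"
        "\<lambda>_. some_set" _ "(\<lambda>_. \<zero>)(2 := m)"]) auto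

lemma add_commute: "m \<oplus> n = n \<oplus> m"
  by (rule sigma_induct[of "Eq (Add (Var 2) (Var 0)) (Add (Var 0) (Var 2))"
        "\<lambda>_. some_set" _ "(\<lambda>_. \<zero>)(2 := m)"]) (auto simp: succ_add)

lemma add_assoc: "l \<oplus> m \<oplus> n = l \<oplus> (m \<oplus> n)"
  by (rule sigma_induct[of "Eq (Add (Add (Var 2) (Var 3)) (Var 0)) (Add (Var 2) (Add (Var 3) (Var 0)))"
        "\<lambda>_. some_set" _ "(\<lambda>_. \<zero>)(2 := l, 3 := m)"]) auto

sublocale add: abel_semigroup "add M"
  by unfold_locales (rule add_assoc, rule add_commute)

lemma add_right_cancel [simp]: "m \<oplus> l = n \<oplus> l \<longleftrightarrow> m = n"
proof -
  have "m \<oplus> l = n \<oplus> l \<longrightarrow> m = n"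
    by (rule sigma_induct[of "Imp (Eq (Add (Var 2) (Var 0)) (Add (Var 3) (Var 0))) (Eq (Var 2) (Var 3))"
          "\<lambda>_. some_set" _ "(\<lambda>_. \<zero>)(2 := m, 3 := n)"]) auto
  then show ?thesis by auto
qed

lemma add_left_cancel [simp]: "l \<oplus> m = l \<oplus> n \<longleftrightarrow> m = n"
  by (simp add: add_commute[of l])

text \<open>The predecessor is the witness \<open>Var 1\<close>; the induction hypothesis is not
  consulted, since a successor exhibits its own predecessor.\<close>

lemma zero_or_succ: "n = \<zero> \<or> (\<exists>m. n = m \<oplus> \<one>)"
  by (rule sigma_induct[of "Disj (Eq (Var 0) Zero) (Eq (Var 0) (Add (Var 1) One))"
        "\<lambda>_. some_set" _ "\<lambda>_. \<zero>"]) auto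

lemma lt_add_succ: "m \<prec> m \<oplus> d \<oplus> \<one>"
  by (rule sigma_induct[of "Lt (Var 2) (Add (Add (Var 2) (Var 0)) One)"
        "\<lambda>_. some_set" _ "(\<lambda>_. \<zero>)(2 := m)"]) auto

lemma lt_iff_add: "m \<prec> n \<longleftrightarrow> (\<exists>d. n = m \<oplus> d \<oplus> \<one>)"
proof -
  \<comment> \<open>The quantifier over the difference \<open>d\<close> is pulled in front of the
    implication, so that the claim is existential over a bounded formula.\<close>
  have "\<exists>d. m \<prec> n \<longrightarrow> n = m \<oplus> d \<oplus> \<one>"
  proof (rule sigma_induct[of "Imp (Lt (Var 2) (Var 0)) (Eq (Var 0) (Add (Add (Var 2) (Var 1)) One))"
          "\<lambda>_. some_set" "\<lambda>n. \<exists>d. m \<prec> n \<longrightarrow> n = m \<oplus> d \<oplus> \<one>" "(\<lambda>_. \<zero>)(2 := m)"])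
    fix n
    assume "\<exists>d. m \<prec> n \<longrightarrow> n = m \<oplus> d \<oplus> \<one>"
    then obtain d where d: "m \<prec> n \<Longrightarrow> n = m \<oplus> d \<oplus> \<one>" by blast
    show "\<exists>d. m \<prec> n \<oplus> \<one> \<longrightarrow> n \<oplus> \<one> = m \<oplus> d \<oplus> \<one>"
    proof (cases "m \<prec> n")
      case True
      then show ?thesis using d by (intro exI[of _ "d \<oplus> \<one>"]) simp
    next
      case False
      then show ?thesis by (intro exI[of _ \<zero>]) simp
    qed
  qed auto
  then show ?thesis by (auto simp: lt_add_succ simp del: lt_succ)
qed

lemma lt_irrefl [simp]: "\<not> m \<prec> m"
proof
  assume "m \<prec> m"
  then obtain d where "m = m \<oplus> (d \<oplus> \<one>)" by (auto simp: lt_iff_add)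
  then have "m \<oplus> \<zero> = m \<oplus> (d \<oplus> \<one>)" by simp
  then show False by (metis add_left_cancel succ_neq_zero)
qed

lemma lt_trans:
  assumes "l \<prec> m" and "m \<prec> n"
  shows "l \<prec> n"
proof -
  obtain d e where "m = l \<oplus> d \<oplus> \<one>" "n = m \<oplus> e \<oplus> \<one>"
    using assms lt_iff_add by auto
  then have "n = l \<oplus> (d \<oplus> \<one> \<oplus> e) \<oplus> \<one>"
    by (simp only: add_assoc)
  then show ?thesis by (simp only: lt_add_succ)
qed

lemma lt_linear: "m \<prec> n \<or> m = n \<or> n \<prec> m"
proof (rule sigma_induct[of "Disj (Lt (Var 2) (Var 0)) (Disj (Eq (Var 2) (Var 0)) (Lt (Var 0) (Var 2)))"
          "\<lambda>_. some_set" "\<lambda>n. m \<prec> n \<or> m = n \<or> n \<prec> m" "(\<lambda>_. \<zero>)(2 := m)"])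
  show "m \<prec> \<zero> \<or> m = \<zero> \<or> \<zero> \<prec> m"
    using zero_or_succ[of m] lt_add_succ[of \<zero>] by (auto simp del: lt_succ)
next
  fix n
  assume "m \<prec> n \<or> m = n \<or> n \<prec> m"
  \<comment> \<open>The difference decides: if \<open>d\<close> is zero then \<open>m\<close> is the
    successor of \<open>n\<close>; if \<open>d\<close> is itself a successor, \<open>m\<close> lies
    beyond it.\<close>
  moreover have "m = n \<oplus> \<one> \<or> n \<oplus> \<one> \<prec> m" if lt: "n \<prec> m"
  proof -
    obtain d where d: "m = n \<oplus> d \<oplus> \<one>" using lt lt_iff_add by auto
    have "n \<oplus> \<one> \<prec> n \<oplus> d' \<oplus> \<one> \<oplus> \<one>" for d'
      using lt_add_succ[of "n \<oplus> \<one>" d'] succ_add[of n d'] by metis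
    then show ?thesis using zero_or_succ[of d] d by (auto simp del: lt_succ)
  qed
  ultimately show "m \<prec> n \<oplus> \<one> \<or> m = n \<oplus> \<one> \<or> n \<oplus> \<one> \<prec> m" by auto
qed auto

sublocale lin: linorder "\<lambda>x y. x \<prec> y \<or> x = y" "lt M"
  by unfold_locales (use lt_irrefl lt_trans lt_linear in blast)+

lemma lt_succ_add_left: "n \<prec> m \<oplus> n \<oplus> \<one>"
  using lt_add_succ add_commute by metis

lemma succ_lt_succ:
  assumes "m \<prec> n"
  shows "m \<oplus> \<one> \<prec> n \<oplus> \<one>"
proof -
  obtain d where "n = m \<oplus> d \<oplus> \<one>"
    using assms lt_iff_add by auto
  then have "n \<oplus> \<one> = m \<oplus> \<one> \<oplus> d \<oplus> \<one>"
    by (simp add: succ_add[of m d])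
  then show ?thesis by (simp only: lt_add_succ)
qed

section \<open>Squares and the pairing function\<close>

lemma succ_mul: "(m \<oplus> \<one>) \<otimes> n = m \<otimes> n \<oplus> n"
  by (rule sigma_induct[of "Eq (Mul (Add (Var 2) One) (Var 0)) (Add (Mul (Var 2) (Var 0)) (Var 0))"
        "\<lambda>_. some_set" _ "(\<lambda>_. \<zero>)(2 := m)"]) (auto simp: add.commute add.left_commute)

lemma square_succ: "(m \<oplus> \<one>) \<otimes> (m \<oplus> \<one>) = m \<otimes> m \<oplus> m \<oplus> m \<oplus> \<one>"
  by (simp add: succ_mul)

text \<open>The next square after that of \<open>s\<close> exceeds it by \<open>s + s + 1\<close>.
  Hence a square plus an offset of at most its root stays below every later square.\<close>

lemma square_gap:
  assumes "s \<prec> t"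
  shows "s \<otimes> s \<oplus> s \<prec> t \<otimes> t"
proof -
  have "s \<prec> t \<longrightarrow> s \<otimes> s \<oplus> s \<prec> t \<otimes> t"
  proof (rule sigma_induct[of "Imp (Lt (Var 2) (Var 0))
          (Lt (Add (Mul (Var 2) (Var 2)) (Var 2)) (Mul (Var 0) (Var 0)))"
        "\<lambda>_. some_set" "\<lambda>t. s \<prec> t \<longrightarrow> s \<otimes> s \<oplus> s \<prec> t \<otimes> t" "(\<lambda>_. \<zero>)(2 := s)"])
    fix n
    assume IH: "s \<prec> n \<longrightarrow> s \<otimes> s \<oplus> s \<prec> n \<otimes> n"
    have "s \<otimes> s \<oplus> s \<prec> (s \<oplus> \<one>) \<otimes> (s \<oplus> \<one>)"
      unfolding square_succ by (rule lt_add_succ)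
    moreover have "n \<otimes> n \<prec> (n \<oplus> \<one>) \<otimes> (n \<oplus> \<one>)"
      unfolding square_succ add_assoc[of "n \<otimes> n" n n] by (rule lt_add_succ)
    ultimately show "s \<prec> n \<oplus> \<one> \<longrightarrow> s \<otimes> s \<oplus> s \<prec> (n \<oplus> \<one>) \<otimes> (n \<oplus> \<one>)"
      using IH lt_trans unfolding lt_succ[of s n] by blast
  qed auto
  then show ?thesis using assms by blast
qed

text \<open>With \<open>s = i + j\<close>, the code is the square of \<open>s\<close> plus
  \<open>i\<close>, and adding \<open>j\<close> brings it to the square of \<open>s\<close> plus
  \<open>s\<close>. So codes with different sums lie in disjoint blocks, ordered like the
  sums.\<close>

lemma pair_less_if_sum_less:
  assumes "i \<oplus> j \<prec> i' \<oplus> j'"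
  shows "pair M i j \<prec> pair M i' j'"
proof -
  let ?s = "i \<oplus> j" and ?t = "i' \<oplus> j'"
  have "pair M i j \<oplus> j = ?s \<otimes> ?s \<oplus> ?s"
    by (simp add: pair_def add_assoc)
  then have "pair M i j \<prec> ?s \<otimes> ?s \<oplus> ?s \<oplus> \<one>"
    using lt_add_succ[of "pair M i j" j] by simp
  then have "pair M i j \<prec> ?t \<otimes> ?t"
    using square_gap[OF assms] by (auto intro: lt_trans)
  moreover have "?t \<otimes> ?t \<prec> pair M i' j' \<oplus> \<one>"
    unfolding pair_def by (rule lt_add_succ)
  ultimately show ?thesis
    by (auto intro: lt_trans)
qed

lemma pair_inject [simp]: "pair M i j = pair M i' j' \<longleftrightarrow> i = i' \<and> j = j'"
proof
  assume eq: "pair M i j = pair M i' j'"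
  then have sum: "i \<oplus> j = i' \<oplus> j'"
    using lt_linear[of "i \<oplus> j" "i' \<oplus> j'"] pair_less_if_sum_less[of i j i' j']
      pair_less_if_sum_less[of i' j' i j] by auto
  then have "i = i'"
    using eq by (simp add: pair_def)
  then show "i = i' \<and> j = j'"
    using sum by simp
qed auto

lemma fst_le_pair: "i \<prec> pair M i j \<oplus> \<one>"
  unfolding pair_def by (rule lt_succ_add_left)

text \<open>With \<open>t = i + j\<close>, the chain is j \<le> t \<le> t * t \<le> t * t + i. Both
  bounds on components serve to decode pairs with bounded quantifiers.\<close>

lemma snd_le_pair: "j \<prec> pair M i j \<oplus> \<one>"
proof -
  let ?t = "i \<oplus> j"
  have t_le: "?t \<prec> ?t \<otimes> ?t \<or> ?t = ?t \<otimes> ?t"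
  proof (cases "?t = \<zero>")
    case False
    then obtain u where u: "?t = u \<oplus> \<one>" using zero_or_succ by blast
    have "u \<oplus> \<one> \<prec> (u \<oplus> \<one>) \<otimes> (u \<oplus> \<one>) \<oplus> \<one>"
      using lt_succ_add_left[of "u \<oplus> \<one>" "u \<otimes> u \<oplus> u"]
      by (simp add: square_succ del: mul_succ lt_succ)
    then show ?thesis unfolding u lt_succ .
  qed simp
  have j_le: "j \<prec> ?t \<or> j = ?t"
    using lt_succ_add_left[of j i] by simp
  have sq_le: "?t \<otimes> ?t \<prec> ?t \<otimes> ?t \<oplus> i \<or> ?t \<otimes> ?t = ?t \<otimes> ?t \<oplus> i"
    using lt_add_succ[of "?t \<otimes> ?t" i] unfolding lt_succ .
  show ?thesis
    unfolding pair_def lt_succ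
    by (rule lin.order_trans[OF lin.order_trans[OF j_le t_le] sq_le])
qed

text \<open>Even in a non-standard structure only standard numerals lie below a standard numeral.
  This translates between internal colours and external indices.\<close>

lemma lt_nat_num_iff: "c \<prec> nat_num M k \<longleftrightarrow> (\<exists>j<k. c = nat_num M j)"
  by (induction k) (auto simp: less_Suc_eq)

subsection \<open>Comprehension\<close>

definition Pair_trm :: "trm \<Rightarrow> trm \<Rightarrow> trm" where
  "Pair_trm s t = Add (Mul (Add s t) (Add s t)) s"

lemma tval_Pair [simp]: "tval M e (Pair_trm s t) = pair M (tval M e s) (tval M e t)"
  by (simp add: Pair_trm_def pair_def)

lemma delta_comprehension:
  assumes p: "bounded_fm p" and q: "bounded_fm q" and E: "range E \<subseteq> sets M"
    and Qp: "\<And>x. Q x \<longleftrightarrow> (\<exists>z. sat M (e(0 := x, n := z)) E p)"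
    and Qq: "\<And>x. Q x \<longleftrightarrow> (\<forall>z. sat M (e(0 := x, n := z)) E q)"
  shows "{x. Q x} \<in> sets M"
proof -
  have "sigma01 (Ex n p)" "pi01 (All n q)"
    using p q by (auto simp: sigma01_def pi01_def)
  moreover have "delta01_comprehension M"
    using model by (simp add: RCA0_model_def)
  moreover have "sat M (e(0 := x)) E (Ex n p) \<longleftrightarrow> Q x" "sat M (e(0 := x)) E (All n q) \<longleftrightarrow> Q x" for x
    using Qp Qq by auto
  ultimately obtain X where "X \<in> sets M" "\<forall>x. x \<in> X \<longleftrightarrow> Q x"
    unfolding delta01_comprehension_def using E by (metis (no_types, lifting))
  moreover from this have "X = {x. Q x}" by auto
  ultimately show ?thesis by simp
qed

lemma bounded_comprehension:
  assumes "bounded_fm p" and "range E \<subseteq> sets M"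
    and "\<And>x z. sat M (e(0 := x, Suc 0 := z)) E p \<longleftrightarrow> Q x"
  shows "{x. Q x} \<in> sets M"
  by (rule delta_comprehension[OF assms(1) assms(1) assms(2), where e = e and n = "Suc 0"]) (simp_all add: assms(3))

text \<open>The formulas speak about the components, at variables 1 and 2, with the code at 0 and
  the unbounded witness at 3. Prefixing a decoding by bounded quantifiers keeps them
  bounded.\<close>

lemma delta_comprehension_rel:
  assumes p: "bounded_fm p" and q: "bounded_fm q" and E: "range E \<subseteq> sets M"
    and Qp: "\<And>x y. Q x y \<longleftrightarrow> (\<exists>z. sat M (e(0 := pair M x y, 3 := z, Suc 0 := x, 2 := y)) E p)"
    and Qq: "\<And>x y. Q x y \<longleftrightarrow> (\<forall>z. sat M (e(0 := pair M x y, 3 := z, Suc 0 := x, 2 := y)) E q)"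
  shows "\<exists>X\<in>sets M. \<forall>x y. rel M X x y \<longleftrightarrow> Q x y"
proof -
  define code where "code r =
    Ex 1 (Conj (Lt (Var 1) (Add (Var 0) One))
      (Ex 2 (Conj (Lt (Var 2) (Add (Var 0) One)) (Conj (Eq (Var 0) (Pair_trm (Var 1) (Var 2))) r))))" for r
  have bounded: "bounded_fm (code r)" if "bounded_fm r" for r
    using that by (simp add: code_def)
  have sat_code: "sat M (e(0 := w, 3 := z)) E (code r) \<longleftrightarrow>
      (\<exists>x y. w = pair M x y \<and> sat M (e(0 := pair M x y, 3 := z, Suc 0 := x, 2 := y)) E r)" for w z r
    using fst_le_pair snd_le_pair by (auto simp: code_def simp del: lt_succ)
  have "(\<exists>x y. w = pair M x y \<and> Q x y) \<longleftrightarrow> (\<exists>z. sat M (e(0 := w, 3 := z)) E (code p))" for w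
    unfolding sat_code Qp by blast
  \<comment> \<open>Injectivity of \<open>pair\<close> makes the decoded components independent of
    \<open>z\<close>, so the universal quantifier commutes with the existential decoding. If
    \<open>w\<close> is not a code, both sides are false.\<close>
  moreover have "(\<exists>x y. w = pair M x y \<and> Q x y) \<longleftrightarrow> (\<forall>z. sat M (e(0 := w, 3 := z)) E (code q))" for w
  proof (cases "\<exists>x y. w = pair M x y")
    case True
    then obtain x y where "w = pair M x y" by blast
    then show ?thesis by (simp add: sat_code Qq)
  qed (auto simp: sat_code)
  ultimately have "{w. \<exists>x y. w = pair M x y \<and> Q x y} \<in> sets M"
    by (intro delta_comprehension[OF bounded[OF p] bounded[OF q] E, where e = e and n = 3])
  then show ?thesis
    by (rule rev_bexI) (auto simp: rel_def)
qed

lemma bounded_comprehension_rel: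
  assumes "bounded_fm p" and "range E \<subseteq> sets M"
    and "\<And>x y z. sat M (e(0 := pair M x y, 3 := z, Suc 0 := x, 2 := y)) E p \<longleftrightarrow> Q x y"
  shows "\<exists>X\<in>sets M. \<forall>x y. rel M X x y \<longleftrightarrow> Q x y"
  by (rule delta_comprehension_rel[OF assms(1) assms(1) assms(2), where e = e]) (simp_all add: assms(3))

section \<open>Closure of the sets under finite unions and composition with sequences\<close>

lemma union_sets: "A \<in> sets M \<Longrightarrow> B \<in> sets M \<Longrightarrow> A \<union> B \<in> sets M"
  using bounded_comprehension[of "Disj (Mem (Var 0) 0) (Mem (Var 0) 1)" "(\<lambda>_. A)(1 := B)"
      "\<lambda>_. \<zero>" "\<lambda>x. x \<in> A \<or> x \<in> B"]
  by (auto simp: Un_def)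

lemma empty_sets: "{} \<in> sets M"
  using bounded_comprehension[of "Lt (Var 0) Zero" "\<lambda>_. some_set" "\<lambda>_. \<zero>" "\<lambda>x. False"] by auto

lemma UN_sets: "(\<And>i. i < k \<Longrightarrow> D i \<in> sets M) \<Longrightarrow> (\<Union>i<(k::nat). D i) \<in> sets M"
  by (induction k) (auto simp: empty_sets union_sets lessThan_Suc)

lemma is_seq_iff: "is_seq M a \<longleftrightarrow> a \<in> sets M \<and> (\<exists>f. \<forall>n x. rel M a n x \<longleftrightarrow> x = f n)"
  unfolding is_seq_def by metis

lemma not_well_foundedI:
  assumes "a \<in> sets M" and f: "\<And>n x. rel M a n x \<longleftrightarrow> x = f n"
    and dec: "\<And>n. rel M R (f (n \<oplus> \<one>)) (f n)"
  shows "\<not> well_founded M R"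
proof -
  have "is_seq M a" using assms(1) f unfolding is_seq_iff by blast
  moreover have "\<forall>n x y. rel M a n x \<longrightarrow> rel M a (n \<oplus> \<one>) y \<longrightarrow> rel M R y x"
    unfolding f using dec by simp
  ultimately show ?thesis unfolding well_founded_def by blast
qed

lemma transpose_sets:
  assumes "S \<in> sets M"
  shows "\<exists>T\<in>sets M. \<forall>x y. rel M T x y \<longleftrightarrow> rel M S y x"
  by (rule bounded_comprehension_rel[of "Mem (Pair_trm (Var 2) (Var 1)) 0" "\<lambda>_. S" "\<lambda>_. \<zero>"])
    (use assms in \<open>auto simp: rel_def\<close>)

text \<open>As \<open>f n\<close> is the only \<open>z\<close> related to \<open>n\<close>, "some
  such \<open>z\<close> satisfies" and "every such \<open>z\<close> satisfies" agree, which gives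
  the two forms that comprehension needs.\<close>

lemma comp_sets:
  assumes S: "S \<in> sets M" and a: "a \<in> sets M" and f: "\<And>n x. rel M a n x \<longleftrightarrow> x = f n"
  shows "\<exists>T\<in>sets M. \<forall>n v. rel M T n v \<longleftrightarrow> rel M S (f n) v"
  by (rule delta_comprehension_rel[of
        "Conj (Mem (Pair_trm (Var 1) (Var 3)) 0) (Mem (Pair_trm (Var 3) (Var 2)) 1)"
        "Imp (Mem (Pair_trm (Var 1) (Var 3)) 0) (Mem (Pair_trm (Var 3) (Var 2)) 1)"
        "(\<lambda>_. a)(1 := S)" _ "\<lambda>_. \<zero>"])
    (use S a f in \<open>auto simp: rel_def\<close>)

text \<open>Composition acts on the first coordinate only, so it is applied twice with a
  transposition in between. The arguments end up swapped, as wanted for colouring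
  \<open>n < m\<close> by a relation from \<open>f m\<close> to \<open>f n\<close>.\<close>

lemma preimage_sets:
  assumes S: "S \<in> sets M" and a: "a \<in> sets M" and f: "\<And>n x. rel M a n x \<longleftrightarrow> x = f n"
  shows "\<exists>T\<in>sets M. \<forall>n m. rel M T n m \<longleftrightarrow> rel M S (f m) (f n)"
proof -
  obtain T1 where T1: "T1 \<in> sets M" "\<And>n v. rel M T1 n v \<longleftrightarrow> rel M S (f n) v"
    using comp_sets[OF S a f] by blast
  obtain T2 where T2: "T2 \<in> sets M" "\<And>n v. rel M T2 n v \<longleftrightarrow> rel M T1 v n"
    using transpose_sets[OF T1(1)] by blast
  show ?thesis
    using comp_sets[OF T2(1) a f] T1(2) T2(2) by auto
qed

text \<open>Here the externality of \<open>k\<close> matters: the induction runs outside the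
  structure, and each stage is one bounded comprehension with finitely many set parameters.\<close>

lemma least_index_sets:
  assumes "\<And>i. i < (k::nat) \<Longrightarrow> D i \<in> sets M"
  shows "\<exists>F\<in>sets M. \<forall>x c. rel M F x c \<longleftrightarrow> (\<exists>j<k. c = nat_num M j \<and> x \<in> D j \<and> (\<forall>i<j. x \<notin> D i))"
  using assms
proof (induction k)
  case 0
  then show ?case using empty_sets by (auto simp: rel_def)
next
  case (Suc k)
  then obtain F where F: "F \<in> sets M"
    "\<And>x c. rel M F x c \<longleftrightarrow> (\<exists>j<k. c = nat_num M j \<and> x \<in> D j \<and> (\<forall>i<j. x \<notin> D i))"
    by force
  have D: "D k \<in> sets M" and U: "(\<Union>i<k. D i) \<in> sets M"
    using Suc.prems UN_sets[of k D] by auto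
  \<comment> \<open>The new index goes only to points outside all earlier sets, so the assigned
    index remains the least one.\<close>
  have "\<exists>G\<in>sets M. \<forall>x c. rel M G x c \<longleftrightarrow>
      rel M F x c \<or> c = nat_num M k \<and> x \<in> D k \<and> x \<notin> (\<Union>i<k. D i)"
    by (rule bounded_comprehension_rel[of
          "Disj (Mem (Pair_trm (Var 1) (Var 2)) 0)
             (Conj (Eq (Var 2) (Var 4)) (Conj (Mem (Var 1) 1) (Neg (Mem (Var 1) 2))))"
          "(\<lambda>_. F)(1 := D k, 2 := \<Union>i<k. D i)" "(\<lambda>_. \<zero>)(4 := nat_num M k)"])
      (use F(1) D U in \<open>auto simp: rel_def\<close>)
  then obtain G where "G \<in> sets M" "\<And>x c. rel M G x c \<longleftrightarrow>
      rel M F x c \<or> c = nat_num M k \<and> x \<in> D k \<and> x \<notin> (\<Union>i<k. D i)"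
    by blast
  then show ?case
    by (intro bexI[of _ G]) (auto simp: F(2) less_Suc_eq)
qed

subsection \<open>The equivalences\<close>

lemma termination_imp_WRT2:
  assumes tt: "termination_theorem M k"
  shows "WRT2 M k"
  unfolding WRT2_def
proof (intro allI impI, rule ccontr)
  fix P
  assume P: "is_colouring M k P"
    and no: "\<not> (\<exists>c. c \<prec> nat_num M k \<and> (\<exists>X\<in>sets M. \<exists>a. increasing_enumeration M a X \<and>
       (\<forall>i x y. rel M a i x \<longrightarrow> rel M a (i \<oplus> \<one>) y \<longrightarrow> colour M P x y c)))"
  have "\<exists>S\<in>sets M. \<forall>y x. rel M S y x \<longleftrightarrow> x \<prec> y \<and> colour M P x y (nat_num M i)" for i
    by (rule bounded_comprehension_rel[of
          "Conj (Lt (Var 2) (Var 1)) (Mem (Pair_trm (Pair_trm (Var 2) (Var 1)) (Var 4)) 0)"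
          "\<lambda>_. P" "(\<lambda>_. \<zero>)(4 := nat_num M i)"])
      (use P in \<open>auto simp: rel_def colour_def is_colouring_def\<close>)
  then obtain Rs where Rs: "\<And>i. Rs i \<in> sets M"
    "\<And>i x y. rel M (Rs i) y x \<longleftrightarrow> x \<prec> y \<and> colour M P x y (nat_num M i)"
    by metis
  have "\<exists>R\<in>sets M. \<forall>y x. rel M R y x \<longleftrightarrow> x \<prec> y"
    by (rule bounded_comprehension_rel[of "Lt (Var 2) (Var 1)" "\<lambda>_. some_set" "\<lambda>_. \<zero>"]) auto
  then obtain R where R: "R \<in> sets M" "\<And>y x. rel M R y x \<longleftrightarrow> x \<prec> y" by blast
  have "well_founded M (Rs i)" if "i < k" for i
    unfolding well_founded_def
  proof (intro notI, elim exE conjE)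
    fix a
    assume seq: "is_seq M a"
      and "\<forall>n x y. rel M a n x \<longrightarrow> rel M a (n \<oplus> \<one>) y \<longrightarrow> rel M (Rs i) y x"
    then have dec: "x \<prec> y" "colour M P x y (nat_num M i)"
      if "rel M a n x" "rel M a (n \<oplus> \<one>) y" for n x y
      using that Rs by blast+
    from seq obtain f where a: "a \<in> sets M" "\<And>n x. rel M a n x \<longleftrightarrow> x = f n"
      by (auto simp: is_seq_iff)
    text \<open>Since \<open>n \<le> f n\<close>, the range of \<open>f\<close> is defined by a bounded formula, hence it is a set of \<open>M\<close>.\<close>
    have "n \<prec> f n \<oplus> \<one>" for n
    proof (rule sigma_induct[of "Conj (Mem (Pair_trm (Var 0) (Var 1)) 0) (Lt (Var 0) (Add (Var 1) One))"
            "\<lambda>_. a" "\<lambda>n. n \<prec> f n \<oplus> \<one>" "\<lambda>_. \<zero>"])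
      show "\<zero> \<prec> f \<zero> \<oplus> \<one>" using lt_add_succ[of \<zero>] by simp
    next
      fix n
      assume "n \<prec> f n \<oplus> \<one>"
      moreover have "f n \<prec> f (n \<oplus> \<one>)" using dec a by blast
      ultimately have "n \<prec> f (n \<oplus> \<one>)"
        by (auto intro: lt_trans)
      then show "n \<oplus> \<one> \<prec> f (n \<oplus> \<one>) \<oplus> \<one>"
        by (rule succ_lt_succ)
    qed (use a in \<open>auto simp: rel_def\<close>)
    then have "(\<exists>n. rel M a n x) \<longleftrightarrow> (\<exists>n. n \<prec> x \<oplus> \<one> \<and> rel M a n x)" for x
      using a(2) by metis
    then have "{x. \<exists>n. rel M a n x} \<in> sets M"
      by (intro bounded_comprehension[of "Ex 2 (Conj (Lt (Var 2) (Add (Var 0) One)) (Mem (Pair_trm (Var 2) (Var 0)) 0))"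
            "\<lambda>_. a" "\<lambda>_. \<zero>"]) (use a(1) in \<open>auto simp: rel_def\<close>)
    moreover have "increasing_enumeration M a {x. \<exists>n. rel M a n x}"
      using seq dec by (auto simp: increasing_enumeration_def)
    ultimately show False
      using no dec(2) \<open>i < k\<close> lt_nat_num_iff by blast
  qed
  moreover have "\<exists>i<k. rel M (Rs i) y x" if "trans_closure M R y x" for y x
  proof -
    from that obtain s n where s: "is_seq M s" "\<zero> \<prec> n" "rel M s \<zero> y" "rel M s n x"
      "\<forall>i u v. i \<prec> n \<longrightarrow> rel M s i u \<longrightarrow> rel M s (i \<oplus> \<one>) v \<longrightarrow> v \<prec> u"
      unfolding trans_closure_def R(2) by blast
    obtain f where f: "s \<in> sets M" "\<And>n x. rel M s n x \<longleftrightarrow> x = f n"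
      using s(1) by (auto simp: is_seq_iff)
    \<comment> \<open>The chain may have non-standard length, so transitivity of the order is
      iterated by induction inside the structure. The first disjunct discards terms past
      \<open>n\<close>, about which nothing is known; the second covers the start, where
      \<open>f i\<close> is \<open>y\<close> itself.\<close>
    have "n \<prec> i \<or> i = \<zero> \<or> f i \<prec> y" for i
    proof (rule sigma_induct[of "Conj (Mem (Pair_trm (Var 0) (Var 1)) 0)
            (Disj (Lt (Var 2) (Var 0)) (Disj (Eq (Var 0) Zero) (Lt (Var 1) (Var 3))))"
            "\<lambda>_. s" "\<lambda>i. n \<prec> i \<or> i = \<zero> \<or> f i \<prec> y" "(\<lambda>_. \<zero>)(2 := n, 3 := y)"])
      fix i
      assume IH: "n \<prec> i \<or> i = \<zero> \<or> f i \<prec> y"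
      show "n \<prec> i \<oplus> \<one> \<or> i \<oplus> \<one> = \<zero> \<or> f (i \<oplus> \<one>) \<prec> y"
      proof (cases "i \<prec> n")
        case True
        then have "f (i \<oplus> \<one>) \<prec> f i" using s(5) f(2) by blast
        then show ?thesis using IH True s(3) f(2) lt_trans lt_irrefl by metis
      next
        case False
        then show ?thesis using lt_linear[of i n] by auto
      qed
    qed (use f in \<open>auto simp: rel_def\<close>)
    from this[of n] have "x \<prec> y" using s f(2) by auto
    then obtain c where "colour M P x y c" "c \<prec> nat_num M k"
      using P unfolding is_colouring_def by blast
    then show ?thesis using Rs(2) \<open>x \<prec> y\<close> lt_nat_num_iff by auto
  qed
  ultimately have "well_founded M R"
    using tt R(1) Rs(1) unfolding termination_theorem_def by blast
  \<comment> \<open>The identity sequence is decreasing for \<open>R\<close>, which is the converse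
    of the order.\<close>
  moreover have "\<exists>a\<in>sets M. \<forall>n x. rel M a n x \<longleftrightarrow> x = n"
    by (rule bounded_comprehension_rel[of "Eq (Var 2) (Var 1)" "\<lambda>_. some_set" "\<lambda>_. \<zero>"]) auto
  then obtain a where "a \<in> sets M" "\<And>n x. rel M a n x \<longleftrightarrow> x = n" by blast
  then have "\<not> well_founded M R"
    by (rule not_well_foundedI) (simp add: R(2))
  ultimately show False by blast
qed

lemma WRT2_imp_weak_H_closure:
  assumes wrt: "WRT2 M k"
  shows "weak_H_closure M k"
  unfolding weak_H_closure_def H_well_founded_def
proof (intro allI impI notI, elim exE conjE)
  fix Rs :: "nat \<Rightarrow> 'a set" and a
  assume Rs: "\<forall>i<k. Rs i \<in> sets M \<and> well_founded M (Rs i)" and "is_seq M a"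
    and "\<forall>n m x y. n \<prec> m \<longrightarrow> rel M a n x \<longrightarrow> rel M a m y \<longrightarrow> rel M (\<Union>i<k. Rs i) y x"
  moreover from this obtain f where a: "a \<in> sets M" "\<And>n x. rel M a n x \<longleftrightarrow> x = f n"
    unfolding is_seq_iff by blast
  ultimately have dec: "\<exists>i<k. rel M (Rs i) (f m) (f n)" if "n \<prec> m" for n m
    using that by (auto simp: rel_def Bex_def)
  \<comment> \<open>The guard \<open>i < k\<close> stands inside the existential so that choice
    yields a family indexed by all naturals.\<close>
  have "\<exists>D. i < k \<longrightarrow> D \<in> sets M \<and> (\<forall>n m. rel M D n m \<longleftrightarrow> rel M (Rs i) (f m) (f n))" for i
    using Rs preimage_sets[OF _ a] by metis
  then obtain D where D: "\<And>i. i < k \<Longrightarrow> D i \<in> sets M"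
    "\<And>i n m. i < k \<Longrightarrow> pair M n m \<in> D i \<longleftrightarrow> rel M (Rs i) (f m) (f n)"
    unfolding rel_def by metis
  obtain F where F: "F \<in> sets M"
    "\<And>x c. rel M F x c \<longleftrightarrow> (\<exists>j<k. c = nat_num M j \<and> x \<in> D j \<and> (\<forall>i<j. x \<notin> D i))"
    using least_index_sets[of k D] D(1) by auto
  have "is_colouring M k F"
    unfolding is_colouring_def colour_def
  proof (intro conjI allI impI)
    fix n m
    assume "n \<prec> m"
    then obtain i where i: "i < k" "pair M n m \<in> D i" using dec D(2) by blast
    then obtain j where j: "pair M n m \<in> D j" "\<forall>l<j. pair M n m \<notin> D l"
      using exists_least_iff[of "\<lambda>l. pair M n m \<in> D l"] by blast
    have "j \<le> i" using i(2) j(2) not_le by blast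
    then have "rel M F (pair M n m) (nat_num M j)"
      unfolding F(2) using i(1) j by (intro exI[of _ j]) auto
    moreover have "c = nat_num M j" if "rel M F (pair M n m) c" for c
    proof -
      from that obtain l where l: "c = nat_num M l" "pair M n m \<in> D l" "\<forall>i<l. pair M n m \<notin> D i"
        using F(2) by blast
      then have "l = j" using j by (metis linorder_neqE_nat)
      then show ?thesis using l(1) by simp
    qed
    ultimately show "\<exists>!c. rel M F (pair M n m) c" by blast
  next
    fix n m c
    assume "rel M F (pair M n m) c"
    then show "c \<prec> nat_num M k" using F(2) lt_nat_num_iff by auto
  qed (rule F(1))
  then obtain c X b where b: "increasing_enumeration M b X"
    and mono: "\<And>i x y. rel M b i x \<Longrightarrow> rel M b (i \<oplus> \<one>) y \<Longrightarrow> rel M F (pair M x y) c"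
    using wrt unfolding WRT2_def colour_def by blast
  obtain g where g: "b \<in> sets M" "\<And>n x. rel M b n x \<longleftrightarrow> x = g n"
    using b by (auto simp: increasing_enumeration_def is_seq_iff)
  have "\<exists>j<k. c = nat_num M j \<and> rel M (Rs j) (f (g (n \<oplus> \<one>))) (f (g n))" for n
  proof -
    have "rel M F (pair M (g n) (g (n \<oplus> \<one>))) c" using mono g(2) by blast
    then obtain j where "j < k" "c = nat_num M j" "pair M (g n) (g (n \<oplus> \<one>)) \<in> D j"
      unfolding F(2) by blast
    then show ?thesis using D(2) by blast
  qed
  \<comment> \<open>The index found above might vary with \<open>n\<close>. The colour
    \<open>c\<close> does not, and distinct numerals are distinct elements, so one index serves the
    whole chain.\<close>
  moreover have "i = j" if "nat_num M i = nat_num M j" for i j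
    by (metis lt_irrefl lt_nat_num_iff nat_neq_iff that)
  ultimately obtain j where j: "j < k" "\<And>n. rel M (Rs j) (f (g (n \<oplus> \<one>))) (f (g n))"
    by metis
  obtain h where h: "h \<in> sets M" "\<And>n x. rel M h n x \<longleftrightarrow> x = f (g n)"
    using comp_sets[OF a(1) g] unfolding a(2) by blast
  then have "\<not> well_founded M (Rs j)"
    using j(2) by (rule not_well_foundedI)
  then show False using Rs j(1) by blast
qed

lemma weak_H_closure_imp_termination:
  assumes wh: "weak_H_closure M k"
  shows "termination_theorem M k"
  unfolding termination_theorem_def
proof (intro ballI impI, elim exE conjE)
  fix R Rs
  assume Rs: "\<forall>i<k. Rs i \<in> sets M \<and> well_founded M (Rs i)"
    and cover: "\<forall>x y. trans_closure M R x y \<longrightarrow> (\<exists>i<k. rel M (Rs i) x y)"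
  show "well_founded M R"
    unfolding well_founded_def
  proof (intro notI, elim exE conjE)
    fix a
    assume seq: "is_seq M a" and "\<forall>n x y. rel M a n x \<longrightarrow> rel M a (n \<oplus> \<one>) y \<longrightarrow> rel M R y x"
    then obtain f where a: "a \<in> sets M" "\<And>n x. rel M a n x \<longleftrightarrow> x = f n"
      and dec: "\<And>n. rel M R (f (n \<oplus> \<one>)) (f n)"
      by (auto simp: is_seq_iff)
    have "trans_closure M R (f m) (f n)" if lt: "n \<prec> m" for n m
    proof -
      obtain d where d: "m = n \<oplus> (d \<oplus> \<one>)"
        using lt by (auto simp: lt_iff_add)
      \<comment> \<open>The chain from \<open>f m\<close> to \<open>f n\<close> reads the sequence
        backwards, along \<open>r i = m - i\<close>. Sequences are total, so \<open>r\<close> takes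
        the default value zero beyond \<open>m\<close>.\<close>
      have "\<exists>!j. i \<oplus> j = m \<or> m \<prec> i \<and> j = \<zero>" for i
      proof (cases "m \<prec> i")
        case True
        moreover have "i \<oplus> j \<noteq> m" for j
          using True lt_add_succ[of i j] lt_trans[of m i] by auto
        ultimately show ?thesis by auto
      next
        case False
        then obtain j where "i \<oplus> j = m"
          using lt_linear[of m i] by (auto simp: lt_iff_add) (metis add_zero, metis add_succ)
        then show ?thesis using False by auto
      qed
      then obtain r where r: "\<And>i j. (i \<oplus> j = m \<or> m \<prec> i \<and> j = \<zero>) \<longleftrightarrow> j = r i"
        by metis
      have "\<exists>D\<in>sets M. \<forall>i j. rel M D i j \<longleftrightarrow> j = r i"
        unfolding r[symmetric]
        by (rule bounded_comprehension_rel[of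
              "Disj (Eq (Add (Var 1) (Var 2)) (Var 4)) (Conj (Lt (Var 4) (Var 1)) (Eq (Var 2) Zero))"
              "\<lambda>_. some_set" "(\<lambda>_. \<zero>)(4 := m)"]) auto
      then obtain D where D: "D \<in> sets M" "\<And>i j. rel M D i j \<longleftrightarrow> j = r i" by blast
      obtain s where s: "s \<in> sets M" "\<And>i x. rel M s i x \<longleftrightarrow> x = f (r i)"
        using comp_sets[OF a(1) D] unfolding a(2) by blast
      have r_eq: "r i = j" if "i \<oplus> j = m" for i j
        using r[of i j] that by simp
      have "rel M R (f (r i)) (f (r (i \<oplus> \<one>)))" if i: "i \<prec> d \<oplus> \<one>" for i
      proof -
        obtain j where "d \<oplus> \<one> = i \<oplus> (j \<oplus> \<one>)"
          using i unfolding lt_iff_add by auto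
        \<comment> \<open>For \<open>i\<close> below the chain length \<open>d + 1\<close>, the
          indices \<open>r i\<close> and \<open>r (i + 1)\<close> are consecutive, so the link is an
          instance of \<open>dec\<close>.\<close>
        then have m: "m = i \<oplus> (n \<oplus> j \<oplus> \<one>)"
          unfolding d by (metis add.left_commute add_assoc)
        then have "i \<oplus> \<one> \<oplus> (n \<oplus> j) = m"
          by (simp add: succ_add[of i "n \<oplus> j"])
        then have "r i = n \<oplus> j \<oplus> \<one>" "r (i \<oplus> \<one>) = n \<oplus> j"
          using m by (auto intro: r_eq)
        then show ?thesis using dec by simp
      qed
      moreover have "r \<zero> = m" "r (d \<oplus> \<one>) = n"
        by (rule r_eq, simp add: d add_commute)+
      ultimately show ?thesis
        unfolding trans_closure_def is_seq_iff
        by (intro exI[of _ s] exI[of _ "d \<oplus> \<one>"]) (use s lt_add_succ[of \<zero> d] in auto)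
    qed
    then have "\<forall>n m x y. n \<prec> m \<longrightarrow> rel M a n x \<longrightarrow> rel M a m y \<longrightarrow> rel M (\<Union>i<k. Rs i) y x"
      using cover a(2) by (auto simp: rel_def Bex_def)
    then show False
      using wh Rs seq unfolding weak_H_closure_def H_well_founded_def by blast
  qed
qed

end

theorem theorem4p4:
  fixes M :: "'a l2_structure" and k :: nat
  assumes "RCA0_model M"
  shows "(termination_theorem M k \<longleftrightarrow> WRT2 M k) \<and> (WRT2 M k \<longleftrightarrow> weak_H_closure M k)"
proof -
  interpret RCA0 M by unfold_locales (rule assms)
  show ?thesis
    using termination_imp_WRT2 WRT2_imp_weak_H_closure weak_H_closure_imp_termination by blast
qed

end
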